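(* Let $\mathcal{H}$ be a set (of support states), $\mathcal{A}$ a finite nonempty set of actions, and fix a consequence geometry $Z$ with utilities $U(a\mid H,Z)\in\mathbb{R}$ for $a\in\mathcal{A}$, $H\in\mathcal{H}$, and full-information optimal policy $\pi^*(\cdot,Z):\mathcal{H}\to\mathcal{A}$. Define the equivalence relation $\sim_Z$ on $\mathcal{H}$ by $H\sim_Z H' \Leftrightarrow \pi^*(H,Z)=\pi^*(H',Z)$. Then the coarsest exactly action-sufficient compression for $Z$ is the quotient map $q_Z:\mathcal{H}\to\mathcal{H}/\!\sim_Z$, $H\mapsto [H]_Z$. That is: (i) $q_Z$ is exactly action-sufficient for $Z$; and (ii) for every compression $g:\mathcal{H}\to\mathcal{S}$ that is exactly action-sufficient for $Z$ and all $H,H'\in\mathcal{H}$, $g(H)=g(H')$ implies $H\sim_Z H'$ (so the partition of $\mathcal{H}$ induced by $g$ refines the partition induced by $q_Z$).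
   Context: For each $H\in\mathcal{H}$, $\pi^*(H,Z)$ denotes the element of $\arg\max_{a\in\mathcal{A}}U(a\mid H,Z)$ selected by a fixed tie-breaking rule, so $\pi^*(\cdot,Z)$ is a single-valued function. A compression is a map $g:\mathcal{H}\to\mathcal{S}$ into some set $\mathcal{S}$; its cells are the preimages $g^{-1}(s)$. Exact action sufficiency is evaluated pointwise with compressed policies defined directly on compressed codes: $g$ is exactly action-sufficient for $Z$ if there is a compressed policy $\pi_g(\cdot,Z):\mathcal{S}\to\mathcal{A}$ (a function of the compressed code only) such that $\pi_g(g(H),Z)=\pi^*(H,Z)$ for all $H\in\mathcal{H}$. *)

theory Defs
  imports Complex_Main "HOL-Library.FuncSet" "HOL-Library.Disjoint_Sets"
begin

definition argmax_set :: "'a set \<Rightarrow> ('a \<Rightarrow> real) \<Rightarrow> 'a set" where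
  "argmax_set A u = {a. is_arg_max u (\<lambda>b. b \<in> A) a}"

(* A tie-breaking rule is a choice function on the nonempty sets of actions: one rule,
   applied to the set of optimal actions in every state. *)
definition tie_breaking_rule :: "'a set \<Rightarrow> ('a set \<Rightarrow> 'a) \<Rightarrow> bool" where
  "tie_breaking_rule A tie \<longleftrightarrow> (\<forall>B. B \<subseteq> A \<and> B \<noteq> {} \<longrightarrow> tie B \<in> B)"

definition opt_policy ::
  "'a set \<Rightarrow> ('a \<Rightarrow> 'h \<Rightarrow> 'z \<Rightarrow> real) \<Rightarrow> ('a set \<Rightarrow> 'a) \<Rightarrow> 'z \<Rightarrow> 'h \<Rightarrow> 'a" where
  "opt_policy A U tie Z H = tie (argmax_set A (\<lambda>a. U a H Z))"

(* The argument p is the full-information policy for the consequence geometry in question,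
   S is the set of codes, and g is meant to be a map from Hs to S. *)
definition exactly_action_sufficient ::
  "'h set \<Rightarrow> 'a set \<Rightarrow> ('h \<Rightarrow> 'a) \<Rightarrow> 's set \<Rightarrow> ('h \<Rightarrow> 's) \<Rightarrow> bool" where
  "exactly_action_sufficient Hs A p S g \<longleftrightarrow>
     (\<exists>pg \<in> S \<rightarrow> A. \<forall>H \<in> Hs. pg (g H) = p H)"

definition policy_equiv :: "'h set \<Rightarrow> ('h \<Rightarrow> 'a) \<Rightarrow> ('h \<times> 'h) set" where
  "policy_equiv Hs p = {(H, H'). H \<in> Hs \<and> H' \<in> Hs \<and> p H = p H'}"

definition quotient_proj :: "('h \<times> 'h) set \<Rightarrow> 'h \<Rightarrow> 'h set" where
  "quotient_proj r H = r `` {H}"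

(* Codes outside the image of g have an empty preimage, which is not a block of the partition. *)
definition induced_partition :: "'h set \<Rightarrow> ('h \<Rightarrow> 's) \<Rightarrow> 'h set set" where
  "induced_partition Hs g = {g -` {s} \<inter> Hs | s. s \<in> g ` Hs}"

end

theory Submission
  imports Defs
begin

text \<open>The relation \<open>policy_equiv Hs p\<close> is the kernel of the policy
  \<open>p\<close> on \<open>Hs\<close>. Since \<open>p\<close> is constant on each kernel class, it
  factors through the quotient map, and the factor is a compressed policy
  (\<open>exactly_action_sufficient_quotient_proj\<close>). Conversely, if \<open>p\<close> factors
  through \<open>g\<close> on \<open>Hs\<close>, then states with the same code get the same action,
  so each fibre of \<open>g\<close> lies in one kernel class
  (\<open>exactly_action_sufficient_policy_equiv\<close>). Both arguments work for an arbitrary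
  \<open>p\<close>; optimality enters through \<open>opt_policy_in\<close>, which places the actions
  in \<open>A\<close>.\<close>

lemma argmax_set_subset: "argmax_set A u \<subseteq> A"
  by (auto simp: argmax_set_def is_arg_max_def)

lemma argmax_set_nonempty:
  assumes "finite A" and "A \<noteq> {}"
  shows "argmax_set A u \<noteq> {}"
proof -
  have "Max (u ` A) \<in> u ` A"
    using assms by simp
  then obtain a where a: "a \<in> A" "u a = Max (u ` A)"
    by auto
  then have "is_arg_max u (\<lambda>b. b \<in> A) a"
    using assms by (simp add: is_arg_max_linorder)
  then show ?thesis
    by (auto simp: argmax_set_def)
qed

text \<open>A finite nonempty \<open>A\<close> has a maximiser, so the tie-breaking rule is applied
  to a nonempty subset of \<open>A\<close>. This supplies the codomain condition on the compressed
  policy.\<close>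

lemma opt_policy_in:
  assumes "finite A" and "A \<noteq> {}" and "tie_breaking_rule A tie"
  shows "opt_policy A U tie Z H \<in> A"
proof -
  let ?B = "argmax_set A (\<lambda>a. U a H Z)"
  have "tie ?B \<in> ?B"
    by (rule assms(3)[unfolded tie_breaking_rule_def, rule_format])
      (simp add: argmax_set_subset argmax_set_nonempty assms(1,2))
  then show ?thesis
    unfolding opt_policy_def by (rule subsetD[OF argmax_set_subset])
qed

lemma equiv_policy_equiv: "equiv Hs (policy_equiv Hs p)"
  by (auto simp: policy_equiv_def intro!: equivI refl_onI symI transI)

lemma partition_on_induced_partition: "partition_on Hs (induced_partition Hs g)"
  by (rule partition_onI) (auto simp: induced_partition_def disjnt_def)

text \<open>Every block of \<open>g\<close> is the fibre through some state of \<open>Hs\<close>,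
  and the fibre of \<open>f\<close> through that same state contains it. This turns a pointwise
  implication into refinement of partitions.\<close>

lemma refines_induced_partition:
  assumes "\<And>H H'. \<lbrakk>H \<in> Hs; H' \<in> Hs; g H = g H'\<rbrakk> \<Longrightarrow> f H = f H'"
  shows "refines Hs (induced_partition Hs g) (induced_partition Hs f)"
  unfolding refines_def
proof (intro conjI partition_on_induced_partition ballI)
  fix X assume "X \<in> induced_partition Hs g"
  then obtain H where "H \<in> Hs" "X = g -` {g H} \<inter> Hs"
    by (auto simp: induced_partition_def)
  then have "X \<subseteq> f -` {f H} \<inter> Hs"
    using assms[OF _ \<open>H \<in> Hs\<close>] by blast
  moreover have "f -` {f H} \<inter> Hs \<in> induced_partition Hs f"
    using \<open>H \<in> Hs\<close> by (auto simp: induced_partition_def)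
  ultimately show "\<exists>Y\<in>induced_partition Hs f. X \<subseteq> Y"
    by blast
qed

lemma exactly_action_sufficient_quotient_proj:
  assumes "p \<in> Hs \<rightarrow> A"
  shows "exactly_action_sufficient Hs A p (Hs // policy_equiv Hs p)
    (quotient_proj (policy_equiv Hs p))"
  unfolding exactly_action_sufficient_def
\<comment> \<open>The compressed policy plays the action of an arbitrary representative of the
  class; the choice is harmless because \<open>p\<close> is constant on classes.\<close>
proof (intro bexI[of _ "\<lambda>C. p (SOME H. H \<in> C)"] ballI funcsetI)
  have class_value: "(SOME H'. H' \<in> policy_equiv Hs p `` {H}) \<in> Hs \<and>
    p (SOME H'. H' \<in> policy_equiv Hs p `` {H}) = p H" if "H \<in> Hs" for H
  proof -
    have "H \<in> policy_equiv Hs p `` {H}"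
      using that by (simp add: policy_equiv_def)
    then have "(SOME H'. H' \<in> policy_equiv Hs p `` {H}) \<in> policy_equiv Hs p `` {H}"
      by (rule someI)
    then show ?thesis
      unfolding policy_equiv_def by auto
  qed
  show "p (SOME H'. H' \<in> quotient_proj (policy_equiv Hs p) H) = p H" if "H \<in> Hs" for H
    using class_value[OF that] by (simp add: quotient_proj_def)
  \<comment> \<open>Every code is the class of a state in \<open>Hs\<close>, hence nonempty, so the
    chosen representative really lies in \<open>Hs\<close>, where \<open>p\<close> takes values in
    \<open>A\<close>.\<close>
  show "p (SOME H. H \<in> C) \<in> A" if "C \<in> Hs // policy_equiv Hs p" for C
  proof -
    from that obtain H where "H \<in> Hs" "C = policy_equiv Hs p `` {H}"
      by (rule quotientE)
    then show ?thesis
      using assms class_value by blast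
  qed
qed

text \<open>The action is a function of the code:
  \<open>p H = pg (g H) = pg (g H') = p H'\<close>.\<close>

lemma exactly_action_sufficient_policy_equiv:
  assumes "exactly_action_sufficient Hs A p S g"
    and "H \<in> Hs" and "H' \<in> Hs" and "g H = g H'"
  shows "(H, H') \<in> policy_equiv Hs p"
proof -
  from assms(1) obtain pg where "\<forall>H\<in>Hs. pg (g H) = p H"
    by (auto simp: exactly_action_sufficient_def)
  with assms(2-) have "p H = p H'"
    by metis
  with assms(2,3) show ?thesis
    by (simp add: policy_equiv_def)
qed

theorem proposition1:
  fixes Hs :: "'h set" and A :: "'a set"
    and U :: "'a \<Rightarrow> 'h \<Rightarrow> 'z \<Rightarrow> real" and Z :: 'z
    and tie :: "'a set \<Rightarrow> 'a"
  assumes "finite A" and "A \<noteq> {}"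
    and "tie_breaking_rule A tie"
  shows
    "equiv Hs (policy_equiv Hs (opt_policy A U tie Z)) \<and>
     quotient_proj (policy_equiv Hs (opt_policy A U tie Z))
       \<in> Hs \<rightarrow> Hs // policy_equiv Hs (opt_policy A U tie Z) \<and>
     exactly_action_sufficient Hs A (opt_policy A U tie Z)
       (Hs // policy_equiv Hs (opt_policy A U tie Z))
       (quotient_proj (policy_equiv Hs (opt_policy A U tie Z))) \<and>
     (\<forall>(S :: 's set) g. g \<in> Hs \<rightarrow> S \<and>
        exactly_action_sufficient Hs A (opt_policy A U tie Z) S g \<longrightarrow>
          (\<forall>H\<in>Hs. \<forall>H'\<in>Hs. g H = g H' \<longrightarrow>
             (H, H') \<in> policy_equiv Hs (opt_policy A U tie Z)) \<and>
          refines Hs (induced_partition Hs g)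
            (induced_partition Hs
              (quotient_proj (policy_equiv Hs (opt_policy A U tie Z)))))"
proof (intro conjI allI impI ballI; (elim conjE)?)
  let ?p = "opt_policy A U tie Z"
  have p: "?p \<in> Hs \<rightarrow> A"
    by (intro funcsetI opt_policy_in assms)
  show "equiv Hs (policy_equiv Hs ?p)"
    by (rule equiv_policy_equiv)
  show "quotient_proj (policy_equiv Hs ?p) \<in> Hs \<rightarrow> Hs // policy_equiv Hs ?p"
    by (auto simp: quotient_proj_def intro!: quotientI)
  show "exactly_action_sufficient Hs A ?p (Hs // policy_equiv Hs ?p)
      (quotient_proj (policy_equiv Hs ?p))"
    using p by (rule exactly_action_sufficient_quotient_proj)
  fix S :: "'s set" and g
  assume suff: "exactly_action_sufficient Hs A ?p S g"
  show same: "(H, H') \<in> policy_equiv Hs ?p" if "H \<in> Hs" "H' \<in> Hs" "g H = g H'" for H H'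
    using suff that by (rule exactly_action_sufficient_policy_equiv)
  show "refines Hs (induced_partition Hs g)
      (induced_partition Hs (quotient_proj (policy_equiv Hs ?p)))"
    \<comment> \<open>Related states have equal classes, so the pointwise condition for refinement
      reduces to \<open>same\<close>.\<close>
    unfolding quotient_proj_def
    by (rule refines_induced_partition, rule equiv_class_eq[OF equiv_policy_equiv], rule same)
qed

end
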